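(* In every dimension $n\ge 3$ there exist aperiodic repetitive Meyer sets $X$ in $\mathbb{R}^n$ such that $$\liminf_{T\to\infty}\frac{N_X(T)}{T^{\lceil (n+1)/2\rceil+\epsilon}}=0$$ for every $\epsilon>0$.
   Context: A Delone set in $\mathbb{R}^n$ is a set $X\subset\mathbb{R}^n$ for which there are $r,R>0$ such that each open ball of radius $r$ contains at most one point of $X$ and each closed ball of radius $R$ contains at least one point of $X$. A Meyer set is a Delone set $X$ such that $X-X=\{\mathbf{x}-\mathbf{y}:\mathbf{x},\mathbf{y}\in X\}$ is also a Delone set. $X$ is aperiodic if $X+\mathbf{t}=X$ only for $\mathbf{t}=\mathbf{0}$. $B(\mathbf{x};T)$ is the closed ball of radius $T$ centered at $\mathbf{x}$. $N_X(T)$ is the number of distinct sets $(X\cap B(\mathbf{x};T))-\mathbf{x}$, $\mathbf{x}\in X$. $X$ is repetitive if for each $T>0$ there is a finite $M>0$ such that every closed ball of radius $M$ in $\mathbb{R}^n$ contains, for every $\mathbf{y}\in X$, some $\mathbf{x}\in X$ with $(X\cap B(\mathbf{x};T))-\mathbf{x}=(X\cap B(\mathbf{y};T))-\mathbf{y}$. *)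

theory Defs
  imports "HOL-Analysis.Analysis"
begin

definition delone :: "'a::euclidean_space set \<Rightarrow> bool" where
  "delone X \<longleftrightarrow>
     (\<exists>r>0. \<exists>R>0. (\<forall>c. \<forall>x \<in> X \<inter> ball c r. \<forall>y \<in> X \<inter> ball c r. x = y) \<and>
                    (\<forall>c. X \<inter> cball c R \<noteq> {}))"

text \<open>On sets, the infix minus of HOL is the set-theoretic difference, hence a separate constant
  for the set of differences.\<close>

definition difference_set :: "'a::euclidean_space set \<Rightarrow> 'a set" where
  "difference_set X = {x - y | x y. x \<in> X \<and> y \<in> X}"

definition meyer :: "'a::euclidean_space set \<Rightarrow> bool" where
  "meyer X \<longleftrightarrow> delone X \<and> delone (difference_set X)"

definition aperiodic :: "'a::euclidean_space set \<Rightarrow> bool" where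
  "aperiodic X \<longleftrightarrow> (\<forall>t. (\<lambda>x. x + t) ` X = X \<longrightarrow> t = 0)"

definition patch :: "'a::euclidean_space set \<Rightarrow> real \<Rightarrow> 'a \<Rightarrow> 'a set" where
  "patch X T x = (\<lambda>y. y - x) ` (X \<inter> cball x T)"

text \<open>The cardinality of an infinite set is 0 in HOL; by \<open>finite_patches\<close> below this
  convention plays no role for Meyer sets.\<close>

definition patch_count :: "'a::euclidean_space set \<Rightarrow> real \<Rightarrow> nat" where
  "patch_count X T = card (patch X T ` X)"

definition repetitive :: "'a::euclidean_space set \<Rightarrow> bool" where
  "repetitive X \<longleftrightarrow>
     (\<forall>T>0. \<exists>M>0. \<forall>c. \<forall>y \<in> X. \<exists>x \<in> X \<inter> cball c M. patch X T x = patch X T y)"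

lemma finite_delone_Int_cball:
  assumes "delone X"
  shows "finite (X \<inter> cball c T)"
proof -
  obtain r where r: "r > 0" "\<And>c x y. x \<in> X \<inter> ball c r \<Longrightarrow> y \<in> X \<inter> ball c r \<Longrightarrow> x = y"
    using assms unfolding delone_def by blast
  have "\<not> l islimpt X" for l
  proof
    assume "l islimpt X"
    then have inf: "infinite (X \<inter> ball l r)"
      using r(1) by (simp add: islimpt_eq_infinite_ball)
    then obtain x where "x \<in> X \<inter> ball l r"
      using infinite_imp_nonempty by blast
    then have "X \<inter> ball l r \<subseteq> {x}"
      using r(2) by blast
    with inf show False
      using finite_subset by blast
  qed
  then have "finite (cball c T \<inter> X)"
    by (intro finite_not_islimpt_in_compact) auto
  then show ?thesis
    by (simp add: Int_commute)
qed

lemma finite_patches: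
  assumes "meyer X"
  shows "finite (patch X T ` X)"
proof (rule finite_subset)
  show "patch X T ` X \<subseteq> Pow (difference_set X \<inter> cball 0 T)"
    by (auto simp: patch_def difference_set_def dist_norm norm_minus_commute)
  show "finite (Pow (difference_set X \<inter> cball 0 T))"
    using assms finite_delone_Int_cball unfolding meyer_def by blast
qed

end

theory Submission
  imports Defs
begin

text \<open>
  The set is \<open>\<int>\<^sup>n\<close> with a Toeplitz-like family of defects removed. Single out one coordinate
  \<open>h\<close> and split the remaining \<open>n - 1\<close> coordinates into blocks \<open>A\<close> and \<open>B\<close> of sizes at most
  \<open>n div 2\<close>. The defects of level \<open>j\<close> form a \<open>2 q\<^sub>j\<close>-periodic family of planes on which \<open>h\<close> and
  the coordinates of \<open>A\<close> (for even \<open>j\<close>) or \<open>B\<close> (for odd \<open>j\<close>) are fixed, where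
  \<open>4 q\<^sub>j\<close> divides \<open>q\<^sub>j\<^sub>+\<^sub>1\<close>. The offsets \<open>\<Sum>i<j. q\<^sub>i\<close> in direction \<open>h\<close> keep levels \<open>i < j\<close> at
  distance at least \<open>q\<^sub>i\<close>, which is why \<open>A\<close> and \<open>B\<close> can cover only \<open>n - 1\<close> coordinates.
  Hence a window of size \<open>T < q\<^sub>k\<^sub>+\<^sub>1 / 2\<close> meets at most one plane of level above \<open>k\<close>, giving at most
  \<open>1 + 2 (2 T + 1) ^ (1 + n div 2)\<close> possibilities, while the lower levels are determined by the
  residue of the centre modulo \<open>2 q\<^sub>k\<close>. As \<open>log q\<^sub>k\<^sub>+\<^sub>1 / log q\<^sub>k\<close> tends to infinity, the
  latter factor is negligible for \<open>T\<close> near \<open>q\<^sub>k\<^sub>+\<^sub>1 / 4\<close>. Both parities occur infinitely often,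
  so a period has to vanish in every coordinate.
\<close>

section \<open>Sets of integer points: Delone criterion, patches, periods\<close>

definition int_vec :: "int ^ 'n \<Rightarrow> real ^ 'n" where
  "int_vec z = (\<chi> i. of_int (z $ i))"

lemma int_vec_nth [simp]: "int_vec z $ i = of_int (z $ i)"
  by (simp add: int_vec_def)

lemma int_vec_add: "int_vec (z + w) = int_vec z + int_vec w"
  and int_vec_diff: "int_vec (z - w) = int_vec z - int_vec w"
  and int_vec_0: "int_vec 0 = 0"
  by (simp_all add: vec_eq_iff)

lemma int_vec_eq_iff [simp]: "int_vec z = int_vec w \<longleftrightarrow> z = w"
  by (simp add: vec_eq_iff)

lemma int_vec_ball_unique:
  assumes "int_vec z \<in> ball c (1/2)" "int_vec w \<in> ball c (1/2)"
  shows "z = w"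
proof -
  have "dist (int_vec z) (int_vec w) < 1"
    using assms dist_triangle_half_r[of c "int_vec z" 1 "int_vec w"] by (simp add: dist_commute)
  then have "\<bar>real_of_int (z $ i - w $ i)\<bar> < 1" for i
    using component_le_norm_cart[of "int_vec z - int_vec w" i] by (simp add: dist_norm)
  then have "\<bar>z $ i - w $ i\<bar> < 1" for i
    by (metis of_int_1 of_int_abs of_int_less_iff)
  then show ?thesis
    by (simp add: vec_eq_iff)
qed

text \<open>Rounding each coordinate of \<open>c\<close> down within the class of
  \<open>z $ i\<close> modulo \<open>p\<close> costs at most \<open>p\<close> per coordinate, and
  the l1 norm bounds the Euclidean one.\<close>

lemma congruent_point_near:
  fixes z :: "int ^ 'n" and c :: "real ^ 'n" and p :: int
  assumes "p > 0"
  shows "\<exists>w. (\<forall>i. p dvd w $ i - z $ i) \<and> int_vec w \<in> cball c (CARD('n) * p)"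
proof -
  define m where "m i = \<lfloor>(c $ i - z $ i) / p\<rfloor>" for i
  define w where "w = (\<chi> i. z $ i + p * m i)"
  have "\<bar>(c - int_vec w) $ i\<bar> \<le> p" for i
  proof -
    have "m i \<le> (c $ i - z $ i) / p" "(c $ i - z $ i) / p < m i + 1"
      unfolding m_def by linarith+
    then have "m i * p \<le> c $ i - z $ i" "c $ i - z $ i < (m i + 1) * p"
      using assms by (simp_all add: field_simps)
    then show ?thesis
      by (simp add: w_def algebra_simps)
  qed
  then have "norm (c - int_vec w) \<le> CARD('n) * p"
    using norm_le_l1_cart[of "c - int_vec w"] sum_bounded_above[of UNIV "\<lambda>i. \<bar>(c - int_vec w) $ i\<bar>" p]
    by fastforce
  then have "int_vec w \<in> cball c (CARD('n) * p)"
    by (simp add: dist_norm)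
  moreover have "\<forall>i. p dvd w $ i - z $ i"
    by (simp add: w_def)
  ultimately show ?thesis
    by blast
qed

text \<open>Integrality alone gives uniform discreteness, and one full residue class modulo
  \<open>p\<close> inside \<open>Y\<close> gives relative density.\<close>

lemma delone_int_vec:
  fixes Y :: "(int ^ 'n::finite) set"
  assumes "p > 0" "\<And>w. (\<forall>i. p dvd w $ i - z $ i) \<Longrightarrow> w \<in> Y"
  shows "delone (int_vec ` Y)"
  unfolding delone_def
proof (rule exI[of _ "1/2"], intro exI[of _ "of_int (int CARD('n) * p)"] conjI allI ballI)
  show "x = y" if "x \<in> int_vec ` Y \<inter> ball c (1/2)" "y \<in> int_vec ` Y \<inter> ball c (1/2)" for c x y
    using that int_vec_ball_unique by blast
  show "int_vec ` Y \<inter> cball c (of_int (int CARD('n) * p)) \<noteq> {}" for c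
    using congruent_point_near[OF assms(1), of z c] assms(2) by fastforce
qed (use assms in auto)

lemma patch_int_vec:
  "patch (int_vec ` Y) T (int_vec z) = int_vec ` {v. norm (int_vec v) \<le> T \<and> z + v \<in> Y}"
proof -
  have "int_vec ` Y \<inter> cball (int_vec z) T = int_vec ` ((+) z ` {v. norm (int_vec v) \<le> T \<and> z + v \<in> Y})"
  proof (intro equalityI subsetI)
    fix x assume "x \<in> int_vec ` Y \<inter> cball (int_vec z) T"
    then obtain w where w: "x = int_vec (z + (w - z))" "w \<in> Y" "norm (int_vec (w - z)) \<le> T"
      by (auto simp: dist_norm norm_minus_commute int_vec_diff)
    then show "x \<in> int_vec ` ((+) z ` {v. norm (int_vec v) \<le> T \<and> z + v \<in> Y})"
      unfolding w(1) by (intro imageI) auto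
  qed (auto simp: dist_norm int_vec_add)
  then show ?thesis
    by (simp add: patch_def image_image int_vec_add)
qed

text \<open>The ball lies in the cube of half-side \<open>T\<close>, so agreement on the cube
  suffices. Cubes split by coordinates, which the counting of patches exploits.\<close>

lemma patch_int_vec_cong:
  assumes "\<And>v. \<forall>i. \<bar>real_of_int (v $ i)\<bar> \<le> T \<Longrightarrow> z + v \<in> Y \<longleftrightarrow> w + v \<in> Y"
  shows "patch (int_vec ` Y) T (int_vec z) = patch (int_vec ` Y) T (int_vec w)"
proof -
  have "z + v \<in> Y \<longleftrightarrow> w + v \<in> Y" if "norm (int_vec v) \<le> T" for v
    using that component_le_norm_cart[of "int_vec v"] by (intro assms) (fastforce intro: order_trans)
  then show ?thesis
    unfolding patch_int_vec by (intro arg_cong[where f = "image int_vec"]) auto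
qed

text \<open>Since there are only finitely many patches, a radius that depends on the patch can be
  replaced by the largest one.\<close>

lemma repetitiveI:
  assumes "\<And>T. T > 0 \<Longrightarrow> finite (patch X T ` X)"
    and "\<And>T y. T > 0 \<Longrightarrow> y \<in> X \<Longrightarrow> \<exists>M. \<forall>c. \<exists>x \<in> X \<inter> cball c M. patch X T x = patch X T y"
  shows "repetitive X"
  unfolding repetitive_def
proof (intro allI impI)
  fix T :: real assume T: "T > 0"
  have "\<forall>P \<in> patch X T ` X. \<exists>M. \<forall>c. \<exists>x \<in> X \<inter> cball c M. patch X T x = P"
    using assms(2)[OF T] by blast
  then obtain M where M: "\<And>P c. P \<in> patch X T ` X \<Longrightarrow> \<exists>x \<in> X \<inter> cball c (M P). patch X T x = P"
    by metis
  \<comment> \<open>The inserted 1 keeps the maximum positive, and defined even for an empty set of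
    patches.\<close>
  define N where "N = Max (insert 1 (M ` patch X T ` X))"
  have "M P \<le> N" if "P \<in> patch X T ` X" for P
    unfolding N_def using assms(1)[OF T] that by (intro Max_ge) auto
  then have "\<forall>c. \<forall>y \<in> X. \<exists>x \<in> X \<inter> cball c N. patch X T x = patch X T y"
    using M by (meson IntD1 IntD2 IntI imageI mem_cball order_trans)
  moreover have "N > 0"
    using assms(1)[OF T] unfolding N_def
    by (intro less_le_trans[OF zero_less_one] Max_ge) auto
  ultimately show "\<exists>M>0. \<forall>c. \<forall>y \<in> X. \<exists>x \<in> X \<inter> cball c M. patch X T x = patch X T y"
    by blast
qed

text \<open>A real period carries one integer point to another, so it is itself an integer
  vector.\<close>

lemma aperiodic_int_vec:
  assumes "Y \<noteq> {}" "\<And>s. (\<And>z. z + s \<in> Y \<longleftrightarrow> z \<in> Y) \<Longrightarrow> s = 0"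
  shows "aperiodic (int_vec ` Y)"
  unfolding aperiodic_def
proof (intro allI impI)
  fix t assume t: "(\<lambda>x. x + t) ` int_vec ` Y = int_vec ` Y"
  obtain z where "z \<in> Y" using assms(1) by blast
  then have "int_vec z + t \<in> int_vec ` Y" using t by blast
  then obtain w where "int_vec z + t = int_vec w" by blast
  then have ts: "t = int_vec (w - z)"
    by (simp add: int_vec_diff algebra_simps)
  have "z' + (w - z) \<in> Y \<longleftrightarrow> z' \<in> Y" for z'
  proof -
    have "int_vec (z' + (w - z)) \<in> (\<lambda>x. x + t) ` int_vec ` Y \<longleftrightarrow> z' \<in> Y"
      unfolding ts int_vec_add by auto
    then show ?thesis
      unfolding t by auto
  qed
  then have "w - z = 0"
    by (rule assms(2))
  then show "t = 0"
    unfolding ts by (simp add: int_vec_0)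
qed

section \<open>Spacings, offsets and levels in the direction \<open>h\<close>\<close>

text \<open>Factorial exponents give \<open>spacing (Suc j) = spacing j ^ (j + 3)\<close>, so the
  ratio of consecutive logarithms is unbounded. The shift by 2 makes consecutive exponents differ by
  at least 2 from the start, whence the factor 4 in \<open>spacing_Suc_dvd\<close>.\<close>

definition spacing :: "nat \<Rightarrow> int" where
  "spacing j = 2 ^ fact (j + 2)"

text \<open>The increment \<open>spacing j\<close> is half the modulus \<open>2 * spacing j\<close>
  of level \<open>j\<close>, so that all later levels run midway between consecutive values of level
  \<open>j\<close>.\<close>

definition offset :: "nat \<Rightarrow> int" where
  "offset j = (\<Sum>i<j. spacing i)"

lemma spacing_pos [simp]: "spacing j > 0"
  by (simp add: spacing_def)

lemma spacing_Suc_dvd: "4 * spacing j dvd spacing (Suc j)"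
proof -
  have "fact (j + 2) \<ge> (1::nat)" by (rule fact_ge_1)
  then have "2 + fact (j + 2) \<le> (fact (Suc j + 2) :: nat)"
    by simp
  then have "(2::int) ^ (2 + fact (j + 2)) dvd 2 ^ fact (Suc j + 2)"
    by (rule le_imp_power_dvd)
  then show ?thesis
    unfolding spacing_def power_add by simp
qed

lemma spacing_Suc_ge: "4 * spacing j \<le> spacing (Suc j)"
  using spacing_Suc_dvd[of j] by (intro zdvd_imp_le) auto

lemma spacing_dvd: "i \<le> j \<Longrightarrow> spacing i dvd spacing j"
  unfolding spacing_def by (intro le_imp_power_dvd fact_mono) simp

lemma double_spacing_dvd: "i < j \<Longrightarrow> 2 * spacing i dvd spacing j"
  using spacing_Suc_dvd[of i] spacing_dvd[of "Suc i" j]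
  by (metis Suc_leI dvd_mult_left dvd_trans mult.assoc mult.commute numeral_Bit0_eq_double)

lemma spacing_ge: "int j \<le> spacing j"
proof (induction j)
  case (Suc j)
  then show ?case using spacing_Suc_ge[of j] spacing_pos[of j] by linarith
qed (simp add: less_imp_le)

lemma spacing_inj: "spacing i = spacing j \<longleftrightarrow> i = j"
proof -
  have "strict_mono spacing"
    using spacing_Suc_ge spacing_pos unfolding strict_mono_Suc_iff by (smt (verit))
  then show ?thesis by (simp add: strict_mono_eq)
qed

lemma offset_Suc: "offset (Suc j) = offset j + spacing j"
  by (simp add: offset_def)

lemma spacing_dvd_offset_diff: "i \<le> j \<Longrightarrow> spacing i dvd offset j - offset i"
proof (induction j rule: dec_induct)
  case (step j)
  then show ?case
    using dvd_add[OF step.IH spacing_dvd[of i j]] by (simp add: offset_Suc algebra_simps)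
qed simp

lemma offset_nonneg: "0 \<le> offset j"
  unfolding offset_def by (intro sum_nonneg) (simp add: less_imp_le)

lemma offset_le_spacing: "offset j \<le> spacing j"
proof (induction j)
  case (Suc j)
  then show ?case using spacing_Suc_ge[of j] spacing_pos[of j] unfolding offset_Suc by linarith
qed (simp add: offset_def less_imp_le)

text \<open>The members of this class nearest to 0 are \<open>offset (Suc j)\<close>, at least
  \<open>spacing j\<close>, and \<open>offset (Suc j) - spacing (Suc j)\<close>, at most
  \<open>- 2 * spacing j\<close>. Thus levels above \<open>j\<close> leave a gap around the
  origin.\<close>

lemma spacing_le_abs:
  assumes "spacing (Suc j) dvd u - offset (Suc j)"
  shows "spacing j \<le> \<bar>u\<bar>"
proof -
  obtain m where m: "u = offset (Suc j) + spacing (Suc j) * m"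
    using assms by (metis dvdE add.commute diff_add_cancel)
  have le: "spacing j \<le> offset (Suc j)" "offset (Suc j) \<le> 2 * spacing j"
    using offset_nonneg[of j] offset_le_spacing[of j] by (simp_all add: offset_Suc)
  show ?thesis
  proof (cases "m \<ge> 0")
    case True
    then have "spacing (Suc j) * m \<ge> 0" by (simp add: less_imp_le)
    then show ?thesis using le m by linarith
  next
    case False
    then have "spacing (Suc j) * m \<le> spacing (Suc j) * (- 1)"
      by (intro mult_left_mono) (auto simp: less_imp_le)
    then show ?thesis using le m spacing_Suc_ge[of j] spacing_pos[of j] by linarith
  qed
qed

definition level :: "nat \<Rightarrow> int \<Rightarrow> bool" where
  "level j u \<longleftrightarrow> 2 * spacing j dvd u - offset j"

text \<open>All levels from \<open>i\<close> on share one class modulo \<open>spacing i\<close>,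
  whatever \<open>j\<close> is. This confines the high levels in a small window to a single value of
  the coordinate \<open>h\<close>.\<close>

lemma level_imp_dvd:
  assumes "level j u" "i \<le> j"
  shows "spacing i dvd u - offset i"
proof -
  have "spacing i dvd u - offset j"
    using assms spacing_dvd[OF assms(2)] unfolding level_def by (meson dvd_mult_right dvd_trans)
  from dvd_add[OF this spacing_dvd_offset_diff[OF assms(2)]] show ?thesis by simp
qed

text \<open>The later level forces \<open>u\<close> to be congruent to
  \<open>offset i + spacing i\<close> modulo \<open>2 * spacing i\<close>, half a period away from
  level \<open>i\<close>.\<close>

lemma level_less_False:
  assumes "level i u" "level j u" "i < j"
  shows False
proof -
  have "spacing (Suc i) dvd u - offset (Suc i)"
    using assms by (intro level_imp_dvd[of j]) auto
  then have "2 * spacing i dvd u - offset i - spacing i"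
    using double_spacing_dvd[of i "Suc i"] by (auto simp: offset_Suc diff_diff_eq intro: dvd_trans)
  with assms(1) have "2 * spacing i dvd (u - offset i) - (u - offset i - spacing i)"
    unfolding level_def by (rule dvd_diff)
  then have "2 * spacing i dvd spacing i" by simp
  then have "2 * spacing i \<le> spacing i" by (rule zdvd_imp_le) simp
  then show False using spacing_pos[of i] by linarith
qed

lemma level_unique: "level i u \<Longrightarrow> level j u \<Longrightarrow> i = j"
  using level_less_False by (metis linorder_neqE_nat)

text \<open>Every level lies in the class of \<open>offset 0 = 0\<close> modulo
  \<open>spacing 0 = 4\<close>.\<close>

lemma even_level:
  assumes "level j u"
  shows "even u"
proof -
  have "spacing 0 dvd u"
    using level_imp_dvd[OF assms, of 0] by (simp add: offset_def)
  moreover have "even (spacing 0)"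
    by (simp add: spacing_def)
  ultimately show ?thesis
    by (rule dvd_trans[rotated])
qed

lemma level_offset: "level j (offset j)"
  by (simp add: level_def)

lemma int_dvd_cong: "d dvd u - w \<Longrightarrow> d dvd u \<longleftrightarrow> d dvd w" for d u w :: int
  using dvd_add[of d "u - w" w] dvd_diff[of d u "u - w"] by auto

lemma level_cong: "2 * spacing j dvd u - w \<Longrightarrow> level j u \<longleftrightarrow> level j w"
  unfolding level_def by (intro int_dvd_cong) simp

lemma int_dvd_small_eq:
  fixes d u w :: int
  assumes "d dvd u - w" "\<bar>u - w\<bar> < d"
  shows "u = w"
  using dvd_imp_le_int[of "u - w" d] assms by fastforce

section \<open>The defect set and its splitting into low and high levels\<close>

definition defects :: "'n \<Rightarrow> 'n set \<Rightarrow> 'n set \<Rightarrow> nat set \<Rightarrow> (int ^ 'n) set" where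
  "defects h A B J = {z. \<exists>j\<in>J. level j (z $ h) \<and>
     (\<forall>i\<in>(if even j then A else B). 2 * spacing j dvd z $ i)}"

lemma defects_Un: "defects h A B (J \<union> K) = defects h A B J \<union> defects h A B K"
  unfolding defects_def by blast

lemma defects_split: "defects h A B UNIV = defects h A B {..k} \<union> defects h A B {k<..}"
  unfolding defects_Un[symmetric] by (intro arg_cong[where f = "defects h A B"]) auto

lemma odd_notin_defects: "odd (z $ h) \<Longrightarrow> z \<notin> defects h A B J"
  using even_level unfolding defects_def by blast

text \<open>Every modulus \<open>2 * spacing j\<close> with \<open>j \<le> k\<close> divides
  \<open>2 * spacing k\<close>, so the low levels are jointly periodic.\<close>

lemma defects_atMost_cong:
  assumes "\<And>i. 2 * spacing k dvd z $ i - w $ i"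
  shows "z \<in> defects h A B {..k} \<longleftrightarrow> w \<in> defects h A B {..k}"
proof -
  have d: "2 * spacing j dvd z $ i - w $ i" if "j \<le> k" for i j
    using mult_dvd_mono[OF dvd_refl[of 2] spacing_dvd[OF that]] assms[of i] by (rule dvd_trans)
  have "(level j (z $ h) \<and> (\<forall>i\<in>(if even j then A else B). 2 * spacing j dvd z $ i)) \<longleftrightarrow>
      (level j (w $ h) \<and> (\<forall>i\<in>(if even j then A else B). 2 * spacing j dvd w $ i))" if "j \<le> k" for j
    using level_cong[OF d[OF that]] int_dvd_cong[OF d[OF that]] by simp
  then show ?thesis
    unfolding defects_def by (simp add: Bex_def cong: conj_cong)
qed

text \<open>The levels above \<open>J\<close> lie in one class modulo
  \<open>spacing (Suc J)\<close>, which by \<open>spacing_le_abs\<close> avoids \<open>u\<close> and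
  hence also \<open>w $ h\<close>.\<close>

lemma defects_greaterThan_empty:
  assumes "spacing (Suc J) dvd w $ h - u" "\<bar>u\<bar> < spacing J"
  shows "w \<notin> defects h A B {J<..}"
proof
  assume "w \<in> defects h A B {J<..}"
  then obtain j where "J < j" "level j (w $ h)"
    unfolding defects_def by auto
  then have "spacing (Suc J) dvd w $ h - offset (Suc J)"
    by (intro level_imp_dvd[of j]) auto
  then have "spacing (Suc J) dvd u - offset (Suc J)"
    using int_dvd_cong[of "spacing (Suc J)" "w $ h - offset (Suc J)" "u - offset (Suc J)"] assms(1)
    by simp
  then show False
    using spacing_le_abs assms(2) by fastforce
qed

section \<open>Meyer property and repetitivity\<close>

lemma meyer_defects: "meyer (int_vec ` (- defects h A B UNIV))"
  unfolding meyer_def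
proof
  \<comment> \<open>An even vector plus the all-ones vector has an odd \<open>h\<close>-coordinate
    and is no defect. So the complement contains a full class modulo 2, and the differences within
    that class are all even vectors.\<close>
  have odd: "w + (\<chi> i. 1) \<in> - defects h A B UNIV" if "\<forall>i. 2 dvd w $ i" for w
    unfolding Compl_iff by (rule odd_notin_defects) (use that in simp)
  show "delone (int_vec ` (- defects h A B UNIV))"
  proof (rule delone_int_vec)
    show "w \<in> - defects h A B UNIV" if "\<forall>i. 2 dvd w $ i - (\<chi> i. 1) $ i" for w
      using odd[of "w - (\<chi> i. 1)"] that by simp
  qed simp
  define Z where "Z = {z - w | z w. z \<in> - defects h A B UNIV \<and> w \<in> - defects h A B UNIV}"
  have "delone (int_vec ` Z)"
  proof (rule delone_int_vec)
    show "w \<in> Z" if "\<forall>i. 2 dvd w $ i - 0 $ i" for w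
    proof -
      have "w = (w + (\<chi> i. 1)) - (0 + (\<chi> i. 1))" by simp
      moreover have "w + (\<chi> i. 1) \<in> - defects h A B UNIV" "0 + (\<chi> i. 1) \<in> - defects h A B UNIV"
        using odd[of w] odd[of 0] that by simp_all
      ultimately show ?thesis
        unfolding Z_def by blast
    qed
  qed simp
  also have "int_vec ` Z = difference_set (int_vec ` (- defects h A B UNIV))"
    unfolding Z_def difference_set_def by (force simp: int_vec_diff)
  finally show "delone (difference_set (int_vec ` (- defects h A B UNIV)))" .
qed

text \<open>Choose \<open>J\<close> so large that the window around \<open>z\<close> stays in the
  gap that the levels above \<open>J\<close> leave around 0. The same then holds around every
  \<open>w\<close> congruent to \<open>z\<close> modulo \<open>spacing (Suc J)\<close>, a multiple
  of the period \<open>2 * spacing J\<close> of the remaining levels. Such \<open>w\<close> occur in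
  every large ball.\<close>

lemma repetitive_defects:
  fixes h :: "'n::finite"
  shows "repetitive (int_vec ` (- defects h A B UNIV))"
proof (rule repetitiveI)
  let ?Y = "- defects h A B UNIV"
  show "finite (patch (int_vec ` ?Y) T ` int_vec ` ?Y)" for T
    by (intro finite_patches meyer_defects)
  fix T :: real and y
  assume T: "T > 0" and y: "y \<in> int_vec ` ?Y"
  then obtain z where z: "y = int_vec z" "z \<in> ?Y" by blast
  define J where "J = nat (\<bar>z $ h\<bar> + \<lceil>T\<rceil> + 1)"
  have J: "\<bar>z $ h\<bar> + \<lceil>T\<rceil> < spacing J"
    using spacing_ge[of J] T unfolding J_def by linarith
  define p where "p = spacing (Suc J)"
  have main: "patch (int_vec ` ?Y) T (int_vec w) = patch (int_vec ` ?Y) T (int_vec z) \<and> w \<in> ?Y"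
    if w: "\<forall>i. p dvd w $ i - z $ i" for w
  proof -
    have iff: "w + v \<in> ?Y \<longleftrightarrow> z + v \<in> ?Y" if v: "\<forall>i. \<bar>real_of_int (v $ i)\<bar> \<le> T" for v
    proof -
      have "\<bar>v $ h\<bar> \<le> \<lceil>T\<rceil>"
        using v by (metis le_of_int_ceiling of_int_abs of_int_le_iff order_trans)
      then have "\<bar>(z + v) $ h\<bar> < spacing J"
        using J by simp
      then have "w + v \<notin> defects h A B {J<..}" "z + v \<notin> defects h A B {J<..}"
        using w defects_greaterThan_empty[of J _ h "(z + v) $ h"] by (simp_all add: p_def)
      moreover have "2 * spacing J dvd (w + v) $ i - (z + v) $ i" for i
        using w double_spacing_dvd[of J "Suc J"] by (auto simp: p_def intro: dvd_trans)
      then have "w + v \<in> defects h A B {..J} \<longleftrightarrow> z + v \<in> defects h A B {..J}"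
        by (rule defects_atMost_cong)
      ultimately show ?thesis
        using defects_split[of h A B J] by blast
    qed
    from iff[of 0] z(2) T have "w \<in> ?Y" by simp
    with iff show ?thesis
      by (intro conjI patch_int_vec_cong) auto
  qed
  show "\<exists>M. \<forall>c. \<exists>x \<in> int_vec ` ?Y \<inter> cball c M.
      patch (int_vec ` ?Y) T x = patch (int_vec ` ?Y) T y"
  proof (intro exI allI)
    fix c
    obtain w where "\<forall>i. p dvd w $ i - z $ i" "int_vec w \<in> cball c (int CARD('n) * p)"
      using congruent_point_near[of p z c] unfolding p_def by auto
    then show "\<exists>x \<in> int_vec ` ?Y \<inter> cball c (int CARD('n) * p).
        patch (int_vec ` ?Y) T x = patch (int_vec ` ?Y) T y"
      using main[of w] z(1) by blast
  qed
qed

section \<open>Aperiodicity\<close>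

lemma spacing_unbounded:
  assumes "infinite J" "\<And>j. j \<in> J \<Longrightarrow> 2 * spacing j dvd u"
  shows "u = 0"
proof -
  obtain j where j: "j \<in> J" "nat \<bar>u\<bar> \<le> j"
    using assms(1) infinite_nat_iff_unbounded_le by metis
  have "2 * spacing j dvd u - 0"
    using assms(2) j(1) by simp
  moreover have "\<bar>u - 0\<bar> < 2 * spacing j"
    using j(2) spacing_ge[of j] spacing_pos[of j] by linarith
  ultimately show ?thesis by (rule int_dvd_small_eq)
qed

lemma infinite_even_odd: "infinite {j::nat. even j}" "infinite {j::nat. odd j}"
proof -
  have "\<exists>n\<ge>m. n \<in> {j. even j}" "\<exists>n\<ge>m. n \<in> {j. odd j}" for m :: nat
    by (rule exI[of _ "2 * m"], simp) (rule exI[of _ "Suc (2 * m)"], simp)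
  then show "infinite {j::nat. even j}" "infinite {j::nat. odd j}"
    unfolding infinite_nat_iff_unbounded_le by blast+
qed

text \<open>A period must map each level to itself, so \<open>2 * spacing j\<close> divides the
  coordinates of \<open>s\<close> that level \<open>j\<close> fixes. Each coordinate is fixed by
  infinitely many levels and therefore vanishes in \<open>s\<close>.\<close>

lemma defects_translation:
  fixes h :: "'n::finite" and s :: "int ^ 'n"
  assumes hAB: "h \<notin> A" "h \<notin> B" "A \<noteq> {}" "B \<noteq> {}" "insert h (A \<union> B) = UNIV"
    and inv: "\<And>z. z + s \<in> defects h A B UNIV \<longleftrightarrow> z \<in> defects h A B UNIV"
  shows "s = 0"
proof -
  define C where "C j = (if even j then A else B)" for j :: nat
  have C: "C j \<noteq> {}" "h \<notin> C j" for j
    using hAB unfolding C_def by auto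
  have S: "z \<in> defects h A B UNIV \<longleftrightarrow> (\<exists>j. level j (z $ h) \<and> (\<forall>i\<in>C j. 2 * spacing j dvd z $ i))" for z
    unfolding defects_def C_def by simp
  have key: "2 * spacing j dvd s $ h \<and> (\<forall>i\<in>C j. 2 * spacing j dvd s $ i)" for j
  proof -
    \<comment> \<open>Test points on level \<open>j\<close> with all other coordinates equal to
      \<open>c\<close>: as \<open>C j\<close> is nonempty, being a defect reveals exactly whether
      \<open>2 * spacing j\<close> divides \<open>c\<close>.\<close>
    define u where "u c = (\<chi> i. if i = h then offset j else c)" for c
    have u: "u c \<in> defects h A B UNIV \<longleftrightarrow> 2 * spacing j dvd c" for c
    proof
      assume "u c \<in> defects h A B UNIV"
      then obtain j' where "level j' (offset j)" "\<forall>i\<in>C j'. 2 * spacing j' dvd u c $ i"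
        unfolding S by (auto simp: u_def)
      with level_unique[OF _ level_offset[of j]] have "\<forall>i\<in>C j. 2 * spacing j dvd u c $ i"
        by blast
      moreover obtain i where "i \<in> C j" "i \<noteq> h"
        using C[of j] by blast
      ultimately show "2 * spacing j dvd c"
        by (force simp: u_def)
    next
      assume "2 * spacing j dvd c"
      then have "level j (u c $ h) \<and> (\<forall>i\<in>C j. 2 * spacing j dvd u c $ i)"
        using C[of j] by (auto simp: u_def level_offset)
      then show "u c \<in> defects h A B UNIV"
        unfolding S by blast
    qed
    have "u 0 + s \<in> defects h A B UNIV"
      using u[of 0] inv by simp
    \<comment> \<open>The translate could a priori lie on another level \<open>l\<close>; comparing
      the two divisibility tests for \<open>c\<close> will give \<open>l = j\<close>.\<close>
    then obtain l where l: "level l (offset j + s $ h)" "\<forall>i\<in>C l. 2 * spacing l dvd (u 0 + s) $ i"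
      unfolding S by (auto simp: u_def)
    have sl: "\<forall>i\<in>C l. 2 * spacing l dvd s $ i"
    proof
      fix i assume i: "i \<in> C l"
      then have "2 * spacing l dvd (u 0 + s) $ i" "i \<noteq> h"
        using l(2) C[of l] by auto
      then show "2 * spacing l dvd s $ i"
        by (simp add: u_def)
    qed
    have us: "u c + s \<in> defects h A B UNIV \<longleftrightarrow> 2 * spacing l dvd c" for c
    proof
      assume "u c + s \<in> defects h A B UNIV"
      then obtain l' where "level l' (offset j + s $ h)" "\<forall>i\<in>C l'. 2 * spacing l' dvd (u c + s) $ i"
        unfolding S by (auto simp: u_def)
      with level_unique[OF _ l(1)] have "\<forall>i\<in>C l. 2 * spacing l dvd (u c + s) $ i"
        by blast
      moreover obtain i where i: "i \<in> C l" "i \<noteq> h"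
        using C[of l] by blast
      ultimately have "2 * spacing l dvd c + s $ i"
        by (force simp: u_def)
      then show "2 * spacing l dvd c"
        using i sl by (simp add: dvd_add_left_iff)
    next
      assume "2 * spacing l dvd c"
      then have "level l ((u c + s) $ h) \<and> (\<forall>i\<in>C l. 2 * spacing l dvd (u c + s) $ i)"
        using C[of l] sl l(1) by (auto simp: u_def)
      then show "u c + s \<in> defects h A B UNIV"
        unfolding S by blast
    qed
    have dvd_iff: "2 * spacing j dvd c \<longleftrightarrow> 2 * spacing l dvd c" for c
      using u[of c] us[of c] inv[of "u c"] by simp
    have "2 * spacing j = 2 * spacing l"
    proof (rule zdvd_antisym_nonneg)
      show "2 * spacing j dvd 2 * spacing l" "2 * spacing l dvd 2 * spacing j"
        unfolding dvd_iff[of "2 * spacing l"] dvd_iff[of "2 * spacing j", symmetric] by (rule dvd_refl)+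
    qed (simp_all add: less_imp_le)
    then have "l = j"
      by (simp add: spacing_inj)
    with l(1) sl show ?thesis
      by (simp add: level_def)
  qed
  have "s $ i = 0" for i
  proof -
    consider "i = h" | "i \<in> A" | "i \<in> B" using hAB(5) by blast
    then show ?thesis
    proof cases
      case 1
      then show ?thesis using key spacing_unbounded[of UNIV] by simp
    next
      case 2
      then show ?thesis
        using key by (intro spacing_unbounded[OF infinite_even_odd(1)]) (auto simp: C_def)
    next
      case 3
      then show ?thesis
        using key by (intro spacing_unbounded[OF infinite_even_odd(2)]) (auto simp: C_def)
    qed
  qed
  then show ?thesis
    by (simp add: vec_eq_iff)
qed

lemma aperiodic_defects:
  fixes h :: "'n::finite"
  assumes "h \<notin> A" "h \<notin> B" "A \<noteq> {}" "B \<noteq> {}" "insert h (A \<union> B) = UNIV"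
  shows "aperiodic (int_vec ` (- defects h A B UNIV))"
proof (rule aperiodic_int_vec)
  have "(\<chi> i. 1) \<in> - defects h A B UNIV"
    using odd_notin_defects[of "\<chi> i. 1"] by simp
  then show "- defects h A B UNIV \<noteq> {}"
    by blast
  show "s = 0" if "\<And>z. z + s \<in> - defects h A B UNIV \<longleftrightarrow> z \<in> - defects h A B UNIV" for s
    using assms that by (intro defects_translation) auto
qed

section \<open>Counting patches\<close>

definition plane_window :: "nat \<Rightarrow> 'n set \<Rightarrow> ('n \<Rightarrow> int) \<Rightarrow> (int ^ 'n) set" where
  "plane_window T I d = {v. (\<forall>i. \<bar>v $ i\<bar> \<le> int T) \<and> (\<forall>i\<in>I. v $ i = d i)}"

text \<open>Two high-level defects in the window differ by less than \<open>spacing (Suc k)\<close>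
  in each coordinate. Congruence modulo this number makes their \<open>h\<close>-coordinates equal,
  hence their levels, hence their coordinates in the block of that level. So the trace is empty or a
  single plane section.\<close>

lemma defects_window:
  fixes h :: "'n::finite"
  assumes T: "2 * int T < spacing (Suc k)"
  shows "{v. (\<forall>i. \<bar>v $ i\<bar> \<le> int T) \<and> z + v \<in> defects h A B {k<..}} \<in>
    insert {} (\<Union>I\<in>{insert h A, insert h B}. plane_window T I ` (I \<rightarrow>\<^sub>E {- int T..int T}))"
    (is "?W \<in> _")
proof (cases "?W = {}")
  case False
  define C where "C j = (if even j then A else B)" for j :: nat
  have S: "z \<in> defects h A B {k<..} \<longleftrightarrow>
      (\<exists>j>k. level j (z $ h) \<and> (\<forall>i\<in>C j. 2 * spacing j dvd z $ i))" for z
    unfolding defects_def C_def by auto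
  from False obtain v where v: "\<And>i. \<bar>v $ i\<bar> \<le> int T" "z + v \<in> defects h A B {k<..}"
    by blast
  then obtain j where j: "j > k" "level j (z $ h + v $ h)" "\<forall>i\<in>C j. 2 * spacing j dvd z $ i + v $ i"
    unfolding S by auto
  define I where "I = insert h (C j)"
  \<comment> \<open>Any one defect \<open>v\<close> of the window supplies the fixed coordinates;
    \<open>restrict\<close> makes them an element of the extensional function space to be
    counted.\<close>
  have "?W = plane_window T I (restrict (($) v) I)"
  proof (intro equalityI subsetI)
    fix w assume "w \<in> ?W"
    then obtain l where w: "\<And>i. \<bar>w $ i\<bar> \<le> int T" and
      l: "l > k" "level l (z $ h + w $ h)" "\<forall>i\<in>C l. 2 * spacing l dvd z $ i + w $ i"
      unfolding S by auto
    have small: "\<bar>w $ i - v $ i\<bar> < spacing (Suc k)" for i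
      using w[of i] v(1)[of i] T by linarith
    have "spacing (Suc k) dvd (z $ h + w $ h - offset (Suc k)) - (z $ h + v $ h - offset (Suc k))"
      using j l by (intro dvd_diff level_imp_dvd[of l] level_imp_dvd[of j]) auto
    then have h: "w $ h = v $ h"
      using small by (intro int_dvd_small_eq[of "spacing (Suc k)"]) auto
    then have "l = j"
      using level_unique l(2) j(2) by simp
    have "w $ i = v $ i" if "i \<in> C j" for i
    proof (rule int_dvd_small_eq)
      have "2 * spacing j dvd (z $ i + w $ i) - (z $ i + v $ i)"
        using that l(3) j(3) \<open>l = j\<close> by (intro dvd_diff) auto
      then have "2 * spacing j dvd w $ i - v $ i" by simp
      moreover have "spacing (Suc k) dvd 2 * spacing j"
        using j(1) spacing_dvd[of "Suc k" j] by (intro dvd_mult) auto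
      ultimately show "spacing (Suc k) dvd w $ i - v $ i"
        by (rule dvd_trans[rotated])
    qed (rule small)
    with h w show "w \<in> plane_window T I (restrict (($) v) I)"
      unfolding plane_window_def I_def by auto
  next
    fix w assume "w \<in> plane_window T I (restrict (($) v) I)"
    then have "\<And>i. \<bar>w $ i\<bar> \<le> int T" "\<And>i. i \<in> I \<Longrightarrow> w $ i = v $ i"
      unfolding plane_window_def by auto
    with j show "w \<in> ?W"
      unfolding S I_def by fastforce
  qed
  moreover have "restrict (($) v) I \<in> I \<rightarrow>\<^sub>E {- int T..int T}"
    using v(1) by (auto simp: abs_le_iff minus_le_iff)
  moreover have "I \<in> {insert h A, insert h B}"
    unfolding I_def C_def by simp
  ultimately show ?thesis by blast
qed simp

lemma card_le_of_code:
  assumes "finite K" "code ` Y \<subseteq> K" "\<And>z w. z \<in> Y \<Longrightarrow> w \<in> Y \<Longrightarrow> code z = code w \<Longrightarrow> f z = f w"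
  shows "card (f ` Y) \<le> card K"
proof -
  have "f ` Y \<subseteq> (\<lambda>c. f (inv_into Y code c)) ` (code ` Y)"
  proof
    fix p assume "p \<in> f ` Y"
    then obtain z where z: "z \<in> Y" "p = f z" by blast
    then have "f z = f (inv_into Y code (code z))"
      by (intro assms(3)) (auto simp: inv_into_into f_inv_into_f)
    then show "p \<in> (\<lambda>c. f (inv_into Y code c)) ` (code ` Y)"
      using z by auto
  qed
  also have "\<dots> \<subseteq> (\<lambda>c. f (inv_into Y code c)) ` K"
    using assms(2) by blast
  finally show ?thesis
    using assms(1) by (meson card_image_le card_mono finite_imageI order_trans)
qed

text \<open>A patch is encoded by the residues of its centre modulo \<open>2 * spacing k\<close>,
  which settle the levels up to \<open>k\<close>, and by the trace of the higher levels: empty, or a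
  plane section for one of the two blocks.\<close>

lemma patch_count_defects:
  fixes h :: "'n::finite"
  assumes T: "2 * int T < spacing (Suc k)" and m: "card A \<le> m" "card B \<le> m"
  shows "patch_count (int_vec ` (- defects h A B UNIV)) T \<le>
    nat (2 * spacing k) ^ CARD('n) * (1 + 2 * (2 * T + 1) ^ Suc m)"
proof -
  let ?Y = "- defects h A B UNIV"
  define W where "W z = {v. (\<forall>i. \<bar>v $ i\<bar> \<le> int T) \<and> z + v \<in> defects h A B {k<..}}" for z
  define R where "R z = (\<lambda>i. z $ i mod (2 * spacing k))" for z :: "int ^ 'n"
  define P where "P I = plane_window T I ` (I \<rightarrow>\<^sub>E {- int T..int T})" for I :: "'n set"
  define K where "K = ((UNIV :: 'n set) \<rightarrow>\<^sub>E {0..<2 * spacing k}) \<times> insert {} (P (insert h A) \<union> P (insert h B))"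
  have cardP: "card (P (insert h I)) \<le> (2 * T + 1) ^ Suc m" if "card I \<le> m" for I
  proof -
    have "card (P (insert h I)) \<le> card (insert h I \<rightarrow>\<^sub>E {- int T..int T})"
      unfolding P_def by (intro card_image_le finite_PiE) auto
    also have "\<dots> = (2 * T + 1) ^ card (insert h I)"
    proof -
      have "card {- int T..int T} = 2 * T + 1" by simp
      then show ?thesis
        by (simp only: card_PiE finite prod_constant)
    qed
    also have "\<dots> \<le> (2 * T + 1) ^ Suc m"
    proof (rule power_increasing)
      show "card (insert h I) \<le> Suc m"
        using that by (simp add: card_insert_if)
    qed simp
    finally show ?thesis .
  qed
  have finP: "finite (P I)" for I
    unfolding P_def by (intro finite_imageI finite_PiE) auto
  have "card K = nat (2 * spacing k) ^ CARD('n) * card (insert {} (P (insert h A) \<union> P (insert h B)))"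
    unfolding K_def card_cartesian_product by (subst card_PiE) simp_all
  also have "card (insert {} (P (insert h A) \<union> P (insert h B))) \<le> 1 + 2 * (2 * T + 1) ^ Suc m"
  proof -
    have "card (insert {} (P (insert h A) \<union> P (insert h B))) \<le> Suc (card (P (insert h A) \<union> P (insert h B)))"
      using finP by (simp add: card_insert_if)
    also have "card (P (insert h A) \<union> P (insert h B)) \<le> card (P (insert h A)) + card (P (insert h B))"
      by (rule card_Un_le)
    finally show ?thesis
      using cardP[OF m(1)] cardP[OF m(2)] by linarith
  qed
  finally have cardK: "card K \<le> nat (2 * spacing k) ^ CARD('n) * (1 + 2 * (2 * T + 1) ^ Suc m)"
    by simp
  have "card ((\<lambda>z. patch (int_vec ` ?Y) T (int_vec z)) ` ?Y) \<le> card K"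
  proof (rule card_le_of_code[where code = "\<lambda>z. (R z, W z)"])
    show "finite K"
      unfolding K_def using finP by (intro finite_cartesian_product finite_PiE) auto
    have "W z \<in> insert {} (P (insert h A) \<union> P (insert h B))" for z
      using defects_window[OF T, of z h A B] unfolding W_def P_def by simp
    moreover have "R z \<in> UNIV \<rightarrow>\<^sub>E {0..<2 * spacing k}" for z
      unfolding R_def by auto
    ultimately show "(\<lambda>z. (R z, W z)) ` ?Y \<subseteq> K"
      unfolding K_def by blast
    fix z w assume eq: "(R z, W z) = (R w, W w)"
    show "patch (int_vec ` ?Y) T (int_vec z) = patch (int_vec ` ?Y) T (int_vec w)"
    proof (rule patch_int_vec_cong)
      fix v :: "int ^ 'n" assume "\<forall>i. \<bar>real_of_int (v $ i)\<bar> \<le> real T"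
      then have "\<forall>i. \<bar>v $ i\<bar> \<le> int T"
        by (metis of_int_abs of_int_le_iff of_int_of_nat_eq)
      then have "z + v \<in> defects h A B {k<..} \<longleftrightarrow> w + v \<in> defects h A B {k<..}"
        using eq unfolding W_def by blast
      moreover have "z + v \<in> defects h A B {..k} \<longleftrightarrow> w + v \<in> defects h A B {..k}"
      proof (rule defects_atMost_cong)
        show "2 * spacing k dvd (z + v) $ i - (w + v) $ i" for i
          using eq unfolding R_def by (simp add: mod_eq_dvd_iff fun_eq_iff)
      qed
      ultimately show "z + v \<in> ?Y \<longleftrightarrow> w + v \<in> ?Y"
        using defects_split[of h A B k] by blast
    qed
  qed
  then show ?thesis
    using cardK unfolding patch_count_def image_image by linarith
qed

section \<open>The lower limit of the normalized patch count\<close>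

lemma Liminf_at_top_eq_0:
  fixes f :: "real \<Rightarrow> real"
  assumes nonneg: "\<And>x. 0 \<le> f x" and g: "filterlim g at_top sequentially"
    and lim: "(\<lambda>k. f (g k)) \<longlonglongrightarrow> 0"
  shows "Liminf at_top (\<lambda>x. ereal (f x)) = 0"
proof (rule antisym)
  show "0 \<le> Liminf at_top (\<lambda>x. ereal (f x))"
    using nonneg by (intro Liminf_bounded) simp
  show "Liminf at_top (\<lambda>x. ereal (f x)) \<le> 0"
  proof (rule ccontr)
    assume "\<not> ?thesis"
    then obtain y where y: "0 < ereal y" "ereal y < Liminf at_top (\<lambda>x. ereal (f x))"
      using ereal_dense2[of 0] by (auto simp: not_le)
    \<comment> \<open>A positive number below the lower limit is eventually a lower bound of
      \<open>f\<close>, hence also along \<open>g\<close>.\<close>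
    then have "\<forall>\<^sub>F x in at_top. y < f x"
      using le_Liminf_iff[of "Liminf at_top (\<lambda>x. ereal (f x))" at_top "\<lambda>x. ereal (f x)"] by auto
    then have "\<forall>\<^sub>F k in sequentially. y < f (g k)"
      using g by (rule eventually_compose_filterlim)
    moreover have "\<forall>\<^sub>F k in sequentially. f (g k) < y"
      using order_tendstoD(2)[OF lim] y(1) by simp
    ultimately have "\<forall>\<^sub>F k in sequentially. False"
      by eventually_elim simp
    then show False by simp
  qed
qed

text \<open>With \<open>f = fact (k + 2)\<close>, the residues contribute about
  \<open>2 ^ (f * CARD('n))\<close>, whereas \<open>T powr \<epsilon>\<close> is about
  \<open>2 powr ((k + 3) * f * \<epsilon>)\<close> and outweighs this once \<open>k\<close> is
  large.\<close>

lemma patch_density_bound: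
  fixes h :: "'n::finite" and \<epsilon> :: real
  assumes m: "card A \<le> m" "card B \<le> m" and "\<epsilon> > 0" and k: "\<epsilon> * (real k + 3) \<ge> CARD('n) + 1"
  defines "T \<equiv> (2::nat) ^ (fact (k + 3) - 2)"
  shows "patch_count (int_vec ` (- defects h A B UNIV)) T / T powr (real (Suc m) + \<epsilon>) \<le>
    3 ^ (m + 2) * 2 powr (CARD('n) + 2 * \<epsilon>) * (1 / 2) ^ k"
proof -
  let ?c = "patch_count (int_vec ` (- defects h A B UNIV)) T"
  define f where "f = (fact (k + 2) :: nat)"
  have f: "k \<le> f" "fact (k + 3) = (k + 3) * f"
    using fact_ge_self[of "k + 2"] fact_Suc[of "k + 2"] unfolding f_def by (auto simp: eval_nat_numeral)
  have f1: "1 \<le> f"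
    unfolding f_def by (rule fact_ge_1)
  \<comment> \<open>Ensures that the natural subtraction in the exponent of \<open>T\<close> is
    exact, so that \<open>4 * T = spacing (Suc k)\<close>.\<close>
  have f3: "3 \<le> (k + 3) * f"
    using mult_le_mono[of 3 "k + 3" 1 f] f1 by simp
  have T1: "T \<ge> 1"
    unfolding T_def by simp
  have "4 * int T = 2 ^ (2 + (fact (k + 3) - 2))"
    unfolding T_def power_add by simp
  also have "2 + (fact (k + 3) - 2) = (fact (k + 3) :: nat)"
    using f3 unfolding f(2) by simp
  finally have "4 * int T = spacing (Suc k)"
    unfolding spacing_def by (simp only: eval_nat_numeral add_Suc_right add_Suc add_0_right)
  then have "2 * int T < spacing (Suc k)"
    using T1 by linarith
  then have "?c \<le> nat (2 * spacing k) ^ CARD('n) * (1 + 2 * (2 * T + 1) ^ Suc m)"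
    by (rule patch_count_defects[OF _ m])
  \<comment> \<open>From \<open>T \<ge> 1\<close>: \<open>2 * T + 1 \<le> 3 * T\<close>, and the
    summand 1 is absorbed as a third copy of the power.\<close>
  also have "\<dots> \<le> (2 ^ (f + 1)) ^ CARD('n) * (3 * (3 * T) ^ Suc m)"
  proof (rule mult_le_mono)
    have "nat (2 * spacing k) = 2 ^ (f + 1)"
      unfolding spacing_def f_def by (simp add: nat_mult_distrib nat_power_eq)
    then show "nat (2 * spacing k) ^ CARD('n) \<le> (2 ^ (f + 1)) ^ CARD('n)"
      by simp
    have "1 \<le> (3 * T) ^ Suc m" "(2 * T + 1) ^ Suc m \<le> (3 * T) ^ Suc m"
      using T1 by (intro one_le_power power_mono; simp)+
    then show "1 + 2 * (2 * T + 1) ^ Suc m \<le> 3 * (3 * T) ^ Suc m"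
      by linarith
  qed
  finally have "real ?c \<le> real ((2 ^ (f + 1)) ^ CARD('n) * (3 * (3 * T) ^ Suc m))"
    by (rule of_nat_mono)
  also have "\<dots> = 3 ^ (m + 2) * 2 ^ ((f + 1) * CARD('n)) * real T ^ Suc m"
    by (simp add: power_mult_distrib power_add flip: power_mult)
  also have "2 ^ ((f + 1) * CARD('n)) = (2::real) powr ((real f + 1) * CARD('n))"
    using powr_realpow[of "2::real" "(f + 1) * CARD('n)"] by (simp add: algebra_simps)
  finally have c: "real ?c \<le> 3 ^ (m + 2) * 2 powr ((real f + 1) * CARD('n)) * real T ^ Suc m" .
  have Te: "real T powr \<epsilon> = 2 powr (((real k + 3) * f - 2) * \<epsilon>)"
  proof -
    have "real T = 2 powr real ((k + 3) * f - 2)"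
      unfolding T_def f(2) by (simp add: powr_realpow)
    also have "real ((k + 3) * f - 2) = (real k + 3) * f - 2"
      using f3 by (simp add: of_nat_diff)
    finally show ?thesis by (simp add: powr_powr)
  qed
  have "2 powr ((real f + 1) * CARD('n)) / real T powr \<epsilon> =
      2 powr ((real f + 1) * CARD('n) - ((real k + 3) * f - 2) * \<epsilon>)"
    unfolding Te by (rule powr_diff[symmetric])
  also have "\<dots> \<le> 2 powr (CARD('n) + 2 * \<epsilon> + - real k)"
  proof (rule powr_mono)
    \<comment> \<open>The \<open>+ 1\<close> in the assumption on \<open>k\<close> leaves a surplus
      of \<open>f \<ge> k\<close> in the exponent, which yields the factor
      \<open>(1 / 2) ^ k\<close>.\<close>
    have "real f * (CARD('n) + 1) \<le> real f * (\<epsilon> * (real k + 3))"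
      using k by (intro mult_left_mono) auto
    then show "(real f + 1) * CARD('n) - ((real k + 3) * f - 2) * \<epsilon> \<le> CARD('n) + 2 * \<epsilon> + - real k"
      using f(1) by (simp add: algebra_simps)
  qed simp
  also have "\<dots> = 2 powr (CARD('n) + 2 * \<epsilon>) * (1 / 2) ^ k"
  proof -
    have "(2::real) powr - real k = (1 / 2) ^ k"
      by (simp add: powr_minus powr_realpow power_one_over inverse_eq_divide)
    then show ?thesis
      by (simp only: powr_add)
  qed
  finally have decay: "2 powr ((real f + 1) * CARD('n)) / real T powr \<epsilon> \<le>
    2 powr (CARD('n) + 2 * \<epsilon>) * (1 / 2) ^ k" .
  have "real T powr (real (Suc m) + \<epsilon>) = real T ^ Suc m * real T powr \<epsilon>"
    unfolding powr_add using T1 by (subst powr_realpow) auto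
  then have "?c / T powr (real (Suc m) + \<epsilon>) \<le>
      3 ^ (m + 2) * 2 powr ((real f + 1) * CARD('n)) * real T ^ Suc m / (real T ^ Suc m * real T powr \<epsilon>)"
    using c by (simp only:) (rule divide_right_mono, simp_all)
  also have "\<dots> = 3 ^ (m + 2) * (2 powr ((real f + 1) * CARD('n)) / real T powr \<epsilon>)"
    using T1 by simp
  also have "\<dots> \<le> 3 ^ (m + 2) * (2 powr (CARD('n) + 2 * \<epsilon>) * (1 / 2) ^ k)"
    using decay by (rule mult_left_mono) simp
  finally show ?thesis
    by (simp only: mult.assoc)
qed

lemma Liminf_patch_density:
  fixes h :: "'n::finite" and \<epsilon> :: real
  assumes m: "card A \<le> m" "card B \<le> m" and \<epsilon>: "\<epsilon> > 0"
  shows "Liminf at_top (\<lambda>T::real. ereal (patch_count (int_vec ` (- defects h A B UNIV)) T /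
    T powr (real (Suc m) + \<epsilon>))) = 0"
proof (rule Liminf_at_top_eq_0)
  let ?T = "\<lambda>k. (2::nat) ^ (fact (k + 3) - 2)"
  let ?r = "\<lambda>T::real. patch_count (int_vec ` (- defects h A B UNIV)) T / T powr (real (Suc m) + \<epsilon>)"
  show "0 \<le> ?r T" for T by simp
  have "k \<le> ?T k" for k
  proof -
    have "k + 3 \<le> fact (k + 3)" by (rule fact_ge_self)
    then have "k \<le> fact (k + 3) - 2" by linarith
    also have "\<dots> \<le> ?T k" by (intro less_imp_le less_exp)
    finally show ?thesis .
  qed
  then show "filterlim (\<lambda>k. real (?T k)) at_top sequentially"
    by (intro filterlim_at_top_mono[OF filterlim_real_sequentially] always_eventually allI of_nat_mono)
  show "(\<lambda>k. ?r (real (?T k))) \<longlonglongrightarrow> 0"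
  proof (rule tendsto_sandwich[OF _ _ tendsto_const])
    show "\<forall>\<^sub>F k in sequentially. 0 \<le> ?r (real (?T k))"
      by simp
    have "\<forall>\<^sub>F k in sequentially. \<epsilon> * (real k + 3) \<ge> CARD('n) + 1"
    proof (rule eventually_sequentiallyI)
      fix k :: nat
      assume "nat \<lceil>(CARD('n) + 1) / \<epsilon>\<rceil> \<le> k"
      then have "(CARD('n) + 1) / \<epsilon> \<le> real k + 3" by linarith
      then show "\<epsilon> * (real k + 3) \<ge> CARD('n) + 1"
        using \<epsilon> by (simp add: field_simps)
    qed
    then show "\<forall>\<^sub>F k in sequentially. ?r (real (?T k)) \<le>
        3 ^ (m + 2) * 2 powr (CARD('n) + 2 * \<epsilon>) * (1 / 2) ^ k"
      by eventually_elim (rule patch_density_bound[OF m \<epsilon>])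
    show "(\<lambda>k. 3 ^ (m + 2) * 2 powr (CARD('n) + 2 * \<epsilon>) * (1 / 2) ^ k) \<longlonglongrightarrow> 0"
      by (intro tendsto_mult_right_zero LIMSEQ_power_zero) simp
  qed
qed

theorem theorem2p2:
  assumes "CARD('n::finite) \<ge> 3"
  shows "\<exists>X :: (real ^ 'n) set. aperiodic X \<and> repetitive X \<and> meyer X \<and>
           (\<forall>\<epsilon>>0. Liminf at_top (\<lambda>T::real. ereal (real (patch_count X T) /
              T powr (real_of_int \<lceil>(real CARD('n) + 1) / 2\<rceil> + \<epsilon>))) = 0)"
proof -
  define m where "m = CARD('n) div 2"
  obtain h :: 'n where True by simp
  have card_h: "card (UNIV - {h}) = CARD('n) - 1"
    by (simp add: card_Diff_singleton)
  \<comment> \<open>\<open>A\<close> takes \<open>m\<close> of the coordinates other than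
    \<open>h\<close>, and the remaining \<open>CARD('n) - 1 - m \<le> m\<close> form
    \<open>B\<close>.\<close>
  have "m \<le> card (UNIV - {h})"
    using assms unfolding card_h m_def by linarith
  then obtain A where A: "A \<subseteq> UNIV - {h}" "card A = m"
    by (rule obtain_subset_with_card_n)
  define B where "B = UNIV - {h} - A"
  have B: "card B = CARD('n) - 1 - m"
    unfolding B_def using A card_h by (simp add: card_Diff_subset)
  \<comment> \<open>In dimension 2 the block \<open>B\<close> would be empty.\<close>
  have "card A > 0" "card B > 0"
    unfolding A(2) B unfolding m_def using assms by linarith+
  then have "A \<noteq> {}" "B \<noteq> {}"
    by force+
  let ?X = "int_vec ` (- defects h A B UNIV)"
  have "aperiodic ?X"
    using A(1) \<open>A \<noteq> {}\<close> \<open>B \<noteq> {}\<close> by (intro aperiodic_defects) (auto simp: B_def)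
  moreover have "Liminf at_top (\<lambda>T::real. ereal (real (patch_count ?X T) /
      T powr (real_of_int \<lceil>(real CARD('n) + 1) / 2\<rceil> + \<epsilon>))) = 0" if "\<epsilon> > 0" for \<epsilon>
  proof -
    \<comment> \<open>For either parity of the dimension the required exponent is
      \<open>m + 1\<close>: one for \<open>h\<close> and \<open>m\<close> for the larger
      block.\<close>
    have "\<lceil>(real CARD('n) + 1) / 2\<rceil> = int (Suc m)"
    proof (rule ceiling_unique)
      have "2 * m \<le> CARD('n)" "CARD('n) \<le> 2 * m + 1"
        unfolding m_def by linarith+
      then have "2 * real m \<le> CARD('n)" "CARD('n) \<le> 2 * real m + 1"
        by linarith+
      then show "real_of_int (int (Suc m)) - 1 < (real CARD('n) + 1) / 2"
        "(real CARD('n) + 1) / 2 \<le> real_of_int (int (Suc m))"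
        by simp_all
    qed
    then have "real_of_int \<lceil>(real CARD('n) + 1) / 2\<rceil> = real (Suc m)"
      by (simp only: of_int_of_nat_eq)
    moreover have "card B \<le> m"
      using B unfolding m_def by linarith
    ultimately show ?thesis
      using Liminf_patch_density[OF eq_refl[OF A(2)] _ that] by (simp only:)
  qed
  ultimately show ?thesis
    using repetitive_defects meyer_defects by blast
qed

end
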